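(* Let $n\ge 2$ be an integer and let $\underline{\lambda}=(\lambda,\lambda')$ be a bipartition. Then for every $n\ge l(\underline{\lambda})$ we have $$C'(\mathrm{SL}(n,\mathbb{Q}),V_{\underline{\lambda}})\le\lfloor n/2\rfloor-1,$$ and equality holds if $n\ge n_{\mathrm{B}}(\underline{\lambda})$, where $$n_{\mathrm{B}}(\underline{\lambda})=\max\bigl(2|\deg\underline{\lambda}|+1,\;2l(\lambda),\;2l(\lambda')\bigr).$$
   Context: A partition $\lambda=(\lambda_1,\dots,\lambda_l)$ is a weakly decreasing finite sequence of non-negative integers (trailing zeros are ignored); its length is $l(\lambda)=\max(\{0\}\cup\{i\mid\lambda_i>0\})$ and its size is $|\lambda|=\lambda_1+\cdots+\lambda_{l(\lambda)}$. A bipartition is a pair $\underline{\lambda}=(\lambda,\lambda')$ of partitions, with length $l(\underline{\lambda})=l(\lambda)+l(\lambda')$ and degree $\deg\underline{\lambda}=|\lambda|-|\lambda'|$. For $l(\underline{\lambda})\le n$, $V_{\underline{\lambda}}$ denotes the irreducible algebraic $\mathrm{GL}(n,\mathbb{Q})$-representation (restricted to $\mathrm{SL}(n,\mathbb{Q})$) with highest weight $$\mu_{\underline{\lambda}}=(\mu_1,\dots,\mu_n)=(\lambda_1,\dots,\lambda_{l(\lambda)},0,\dots,0,-\lambda'_{l(\lambda')},\dots,-\lambda'_1).$$ Let $\mathfrak{h}$ be the Cartan subalgebra of traceless diagonal matrices in $sl_n(\mathbb{C})$, with $\mathfrak{h}^*=\mathbb{C}\{L_1,\dots,L_n\}/\mathbb{C}(L_1+\cdots+L_n)$,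 where $L_i$ reads off the $i$-th diagonal entry. The positive roots are $L_i-L_j$ ($i<j$) and the simple roots are $\alpha_i=L_i-L_{i+1}$ ($1\le i\le n-1$). For $\phi\in\mathfrak{h}^*$ write $\phi>0$ if $\phi=\sum_i c_i\alpha_i$ with all $c_i>0$. Equivalently, writing $\phi=[\phi_1,\dots,\phi_n]:=\sum_i\phi_iL_i$ with $\sum_i\phi_i=0$, we have $\phi>0$ iff $\phi_1+\cdots+\phi_i>0$ for all $i=1,\dots,n-1$. The Weyl group $W=\mathfrak{S}_n=\langle s_1,\dots,s_{n-1}\rangle$ acts on $\mathfrak{h}^*$ by permuting the $L_i$ ($s_i$ swaps $L_i$ and $L_{i+1}$). Let $l(\sigma)$ be the length of $\sigma\in W$ with respect to the $s_i$, $W^q=\{\sigma\in W\mid l(\sigma)=q\}$, and let $w_0$ be the longest element, so $l(w_0)=\tfrac12 n(n-1)$. Let $\rho=[\tfrac{n-1}{2},\tfrac{n-3}{2},\dots,-\tfrac{n-1}{2}]$ be half the sum of the positive roots. In $\mathfrak{h}^*$, $$\rho+\mu_{\underline{\lambda}}=\bigl[\tfrac{n-1}{2}-\alpha+\mu_1,\;\tfrac{n-3}{2}-\alpha+\mu_2,\;\dots,\;-\tfrac{n-1}{2}-\alpha+\mu_n\bigr],\qquad \alpha=\tfrac1n\deg\underline{\lambda}.$$ Define $$C'(\mathrm{SL}(n,\mathbb{Q}),V_{\underline{\lambda}})=\max\{q\in\{0,\dots,l(w_0)\}\mid\sigma(\rho+\mu_{\underline{\lambda}})>0\text{ for all }\sigma\in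 W^q\}.$$ *)

theory Defs
  imports Complex_Main "HOL-Combinatorics.Permutations"
begin

text \<open>Partitions are lists of naturals that may end in zeros; every notion below depends only on
  the positive parts.\<close>

definition partition :: "nat list \<Rightarrow> bool" where
  "partition p \<longleftrightarrow> sorted_wrt (\<ge>) p"

definition part :: "nat list \<Rightarrow> nat \<Rightarrow> nat" where
  "part p i = (if 1 \<le> i \<and> i \<le> length p then p ! (i - 1) else 0)"

definition plength :: "nat list \<Rightarrow> nat" where
  "plength p = Max ({0} \<union> {i. part p i > 0})"

definition psize :: "nat list \<Rightarrow> nat" where
  "psize p = (\<Sum>i = 1..plength p. part p i)"

type_synonym bipart = "nat list \<times> nat list"

definition bipartition :: "bipart \<Rightarrow> bool" where
  "bipartition l \<longleftrightarrow> partition (fst l) \<and> partition (snd l)"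

definition bilength :: "bipart \<Rightarrow> nat" where
  "bilength l = plength (fst l) + plength (snd l)"

definition bidegree :: "bipart \<Rightarrow> int" where
  "bidegree l = int (psize (fst l)) - int (psize (snd l))"

text \<open>An element of \<open>\<hh>\<^sup>* = \<complex>{L\<^sub>1,\<dots>,L\<^sub>n}/\<complex>(L\<^sub>1 + \<dots> + L\<^sub>n)\<close> is represented by its coefficients
  \<open>\<phi> 1, \<dots>, \<phi> n\<close> with respect to the \<open>L\<^sub>i\<close> (values at other indices are irrelevant). Two coefficient
  vectors represent the same element iff \<^term>\<open>weight_eq n\<close> relates them, so no normalisation to
  coefficient sum 0 is needed.\<close>

type_synonym weight = "nat \<Rightarrow> complex"

definition weight_eq :: "nat \<Rightarrow> weight \<Rightarrow> weight \<Rightarrow> bool" where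
  "weight_eq n \<phi> \<psi> \<longleftrightarrow> (\<exists>t. \<forall>i\<in>{1..n}. \<phi> i = \<psi> i + t)"

definition L_weight :: "nat \<Rightarrow> weight" where
  "L_weight i = (\<lambda>k. if k = i then 1 else 0)"

definition simple_root :: "nat \<Rightarrow> weight" where
  "simple_root i = (\<lambda>k. L_weight i k - L_weight (i + 1) k)"

definition positive_weight :: "nat \<Rightarrow> weight \<Rightarrow> bool" where
  "positive_weight n \<phi> \<longleftrightarrow>
     (\<exists>c :: nat \<Rightarrow> real. (\<forall>i\<in>{1..<n}. c i > 0) \<and>
        weight_eq n \<phi> (\<lambda>k. \<Sum>i\<in>{1..<n}. complex_of_real (c i) * simple_root i k))"

text \<open>Half the sum of the positive roots \<open>L\<^sub>i - L\<^sub>j\<close>, \<open>i < j\<close>.\<close>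

definition rho :: "nat \<Rightarrow> weight" where
  "rho n = (\<lambda>k. (\<Sum>j = 1..n. \<Sum>i\<in>{1..<j}. L_weight i k - L_weight j k) / 2)"

definition highest_weight :: "nat \<Rightarrow> bipart \<Rightarrow> nat \<Rightarrow> int" where
  "highest_weight n l i =
     (if i \<le> plength (fst l) then int (part (fst l) i)
      else if i \<le> n - plength (snd l) then 0
      else - int (part (snd l) (n + 1 - i)))"

definition rho_plus_mu :: "nat \<Rightarrow> bipart \<Rightarrow> weight" where
  "rho_plus_mu n l = (\<lambda>k. rho n k + of_int (highest_weight n l k))"

definition weyl_group :: "nat \<Rightarrow> (nat \<Rightarrow> nat) set" where
  "weyl_group n = {\<sigma>. \<sigma> permutes {1..n}}"

definition simple_reflection :: "nat \<Rightarrow> nat \<Rightarrow> nat" where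
  "simple_reflection i = transpose i (i + 1)"

definition weyl_length :: "nat \<Rightarrow> (nat \<Rightarrow> nat) \<Rightarrow> nat" where
  "weyl_length n \<sigma> =
     (LEAST k. \<exists>is. length is = k \<and> set is \<subseteq> {1..<n} \<and>
        \<sigma> = foldr (\<circ>) (map simple_reflection is) id)"

definition weyl_of_length :: "nat \<Rightarrow> nat \<Rightarrow> (nat \<Rightarrow> nat) set" where
  "weyl_of_length n q = {\<sigma> \<in> weyl_group n. weyl_length n \<sigma> = q}"

definition longest_element :: "nat \<Rightarrow> nat \<Rightarrow> nat" where
  "longest_element n = arg_max_on (weyl_length n) (weyl_group n)"

text \<open>\<open>\<sigma>\<close> sends \<open>L\<^sub>i\<close> to \<open>L\<^bsub>\<sigma> i\<^esub>\<close>, so the coefficient of \<open>L\<^sub>k\<close> moves there from \<open>\<sigma>\<inverse> k\<close>.\<close>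

definition weyl_act :: "(nat \<Rightarrow> nat) \<Rightarrow> weight \<Rightarrow> weight" where
  "weyl_act \<sigma> \<phi> = (\<lambda>k. \<phi> (inv \<sigma> k))"

text \<open>\<open>C'(SL(n,\<rat>), V)\<close> for the irreducible representation \<open>V\<close> labelled by the bipartition \<open>l\<close>; it
  depends on \<open>V\<close> only through its highest weight.\<close>

definition C' :: "nat \<Rightarrow> bipart \<Rightarrow> nat" where
  "C' n l =
     Max {q \<in> {0..weyl_length n (longest_element n)}.
            \<forall>\<sigma> \<in> weyl_of_length n q. positive_weight n (weyl_act \<sigma> (rho_plus_mu n l))}"

definition n_B :: "bipart \<Rightarrow> int" where
  "n_B l = Max {2 * \<bar>bidegree l\<bar> + 1, 2 * int (plength (fst l)), 2 * int (plength (snd l))}"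

end

theory Submission
  imports Defs
begin

text \<open>
  Write \<open>w\<close> for the coefficient vector \<open>\<rho> + \<mu>\<close>; it is real and strictly decreasing. For a set \<open>A\<close> of
  positions, its excess compares the sum of \<open>w\<close> over \<open>A\<close> with the share \<open>|A|/n\<close> of the total, so it
  is \<open>n\<close> times the partial sum of the traceless representative. Thus \<open>\<sigma>(\<rho> + \<mu>) > 0\<close> says
  that each set \<open>\<sigma>\<inverse>{1..i}\<close> with \<open>0 < i < n\<close> has positive excess
  (\<open>positive_weyl_act_iff_excess\<close>).

  \<^bold>\<open>Upper bound.\<close> The middle position \<open>k = \<lfloor>n/2\<rfloor> + 1\<close> can be moved to the first place or to the
  last place by at most \<open>\<lfloor>n/2\<rfloor>\<close> adjacent transpositions. If the entry at \<open>k\<close> is at most the mean, the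
  former destroys the first inequality; otherwise the latter destroys the last one
  (\<open>exists_short_nonpos_excess\<close>). A failure then survives to every larger length: as long as \<open>\<sigma>\<close> is not
  the longest element, some \<open>s\<^sub>j\<close> increases its length by one, and left multiplication by it replaces
  one partial sum by a smaller one and keeps all the others (\<open>nonpos_excess_persists\<close>). Hence
  every length from \<open>\<lfloor>n/2\<rfloor>\<close> to the maximum contains a failing element.

  \<^bold>\<open>Equality.\<close> Call a pair \<open>x < y\<close> with \<open>x \<notin> A\<close> and \<open>y \<in> A\<close> a crossing of \<open>A\<close>. Their number is
  the sum of \<open>A\<close> minus its least possible value, so for \<open>A = \<sigma>\<inverse>{1..i}\<close> it is at most the length of
  \<open>\<sigma>\<close>, since a simple reflection changes the sum of a set by at most one. What remains is that a set
  with fewer than \<open>\<lfloor>n/2\<rfloor>\<close> crossings has positive excess (\<open>excess_pos_of_few_crossings\<close>). The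
  contribution of \<open>\<rho>\<close> is explicit in \<open>|A|\<close> and the number of crossings. For \<open>\<mu>\<close>, few crossings force \<open>A\<close>
  to be at least as dense in every initial segment of length at most \<open>n/2\<close> as in every final
  segment of such length (\<open>prefix_density_ge_suffix_density\<close>). So some slope \<open>\<theta> \<in> [0, 1]\<close> separates these
  densities, and summation by parts gives that \<open>\<mu>\<close> summed over \<open>A\<close> is at least \<open>\<theta>\<close> times the
  degree (\<open>highest_weight_sum_ge_slope\<close>). This uses that both partitions have length at most \<open>n/2\<close>. The
  error \<open>|\<theta> - |A|/n|\<close> times the degree, whose absolute value is below \<open>n/2\<close>, is then absorbed by
  the contribution of \<open>\<rho>\<close>.
\<close>

section \<open>Positivity as a condition on partial sums\<close>

text \<open>Scaling by \<open>n\<close> instead of subtracting the mean keeps this independent of the coefficient vector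
  that represents an element of the dual Cartan algebra: adding a constant to \<open>w\<close> changes nothing.\<close>

definition excess :: "nat \<Rightarrow> (nat \<Rightarrow> real) \<Rightarrow> nat set \<Rightarrow> real" where
  "excess n w A = real n * sum w A - real (card A) * sum w {1..n}"

lemma sum_simple_root_combination:
  assumes "k \<in> {1..n}"
  shows "(\<Sum>i\<in>{1..<n}. complex_of_real (c i) * simple_root i k) =
    complex_of_real ((if k < n then c k else 0) - (if 1 < k then c (k - 1) else 0))"
proof -
  have "(\<Sum>i\<in>{1..<n}. complex_of_real (c i) * simple_root i k) =
      (\<Sum>i\<in>{1..<n}. if i = k then complex_of_real (c i) else 0)
      - (\<Sum>i\<in>{1..<n}. if i = k - 1 then complex_of_real (c i) else 0)"
    using assms unfolding sum_subtractf[symmetric]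
    by (intro sum.cong) (auto simp: simple_root_def L_weight_def)
  then show ?thesis
    using assms by (auto simp: sum.delta)
qed

lemma sum_telescope_coefficients:
  fixes c :: "nat \<Rightarrow> real"
  assumes "1 \<le> j" "j \<le> n"
  shows "(\<Sum>k=1..j. (if k < n then c k else 0) - (if 1 < k then c (k - 1) else 0)) =
    (if j < n then c j else 0)"
  using assms by (induction j rule: nat_induct_at_least) auto

text \<open>The coefficient of \<open>\<alpha>\<^sub>i\<close> is the \<open>i\<close>-th partial sum of the representative with sum zero, because
  partial sums of a combination of simple roots telescope. The complex shift \<open>t\<close> relating two
  representatives is determined by the total sum.\<close>

lemma positive_weight_iff_partial_sums:
  assumes n: "n \<ge> 1" and \<phi>: "\<And>k. k \<in> {1..n} \<Longrightarrow> \<phi> k = complex_of_real (w k)"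
  shows "positive_weight n \<phi> \<longleftrightarrow>
    (\<forall>i\<in>{1..<n}. real i * (\<Sum>k=1..n. w k) < real n * (\<Sum>k=1..i. w k))"
proof
  assume "positive_weight n \<phi>"
  then obtain c t where c: "\<forall>i\<in>{1..<n}. c i > 0"
    and t: "\<And>k. k \<in> {1..n} \<Longrightarrow>
        \<phi> k = (\<Sum>i\<in>{1..<n}. complex_of_real (c i) * simple_root i k) + t"
    unfolding positive_weight_def weight_eq_def by blast
  define d where "d k = (if k < n then c k else 0) - (if 1 < k then c (k - 1) else 0)" for k
  have eq: "complex_of_real (w k) = complex_of_real (d k) + t" if "k \<in> {1..n}" for k
    using \<phi>[OF that] t[OF that] sum_simple_root_combination[OF that, of c] by (simp add: d_def)
  have w: "w k = d k + Re t" if "k \<in> {1..n}" for k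
    using arg_cong[OF eq[OF that], of Re] by simp
  have S: "(\<Sum>k=1..j. w k) = (if j < n then c j else 0) + real j * Re t"
    if "1 \<le> j" "j \<le> n" for j
  proof -
    have "(\<Sum>k=1..j. w k) = (\<Sum>k=1..j. d k + Re t)"
      using that w by (intro sum.cong) auto
    then show ?thesis
      using sum_telescope_coefficients[OF that, of c] by (simp add: sum.distrib d_def)
  qed
  show "\<forall>i\<in>{1..<n}. real i * (\<Sum>k=1..n. w k) < real n * (\<Sum>k=1..i. w k)"
    using S n c by (auto simp: algebra_simps)
next
  assume pos: "\<forall>i\<in>{1..<n}. real i * (\<Sum>k=1..n. w k) < real n * (\<Sum>k=1..i. w k)"
  define t where "t = (\<Sum>k=1..n. w k) / real n"
  define c where "c i = (\<Sum>k=1..i. w k) - real i * t" for i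
  have "c i > 0" if "i \<in> {1..<n}" for i
    using pos[rule_format, OF that] n by (simp add: c_def t_def field_simps)
  moreover have "\<phi> k = (\<Sum>i\<in>{1..<n}. complex_of_real (c i) * simple_root i k)
      + complex_of_real t" if k: "k \<in> {1..n}" for k
  proof -
    have cn: "c n = 0"
      using n by (simp add: c_def t_def)
    have c0: "c 0 = 0"
      by (simp add: c_def)
    have "(if k < n then c k else 0) - (if 1 < k then c (k - 1) else 0) = c k - c (k - 1)"
      using k cn c0 by (cases "k = 1"; cases "k = n") auto
    also have "\<dots> = w k - t"
      using k by (cases k) (auto simp: c_def algebra_simps)
    finally show ?thesis
      using \<phi>[OF k] sum_simple_root_combination[OF k, of c] by (simp flip: of_real_add)
  qed
  ultimately show "positive_weight n \<phi>"
    unfolding positive_weight_def weight_eq_def by blast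
qed

lemma positive_weyl_act_iff_excess:
  assumes n: "n \<ge> 1" and \<sigma>: "\<sigma> permutes {1..n}"
    and \<phi>: "\<And>k. k \<in> {1..n} \<Longrightarrow> \<phi> k = complex_of_real (w k)"
  shows "positive_weight n (weyl_act \<sigma> \<phi>) \<longleftrightarrow>
    (\<forall>i\<in>{1..<n}. 0 < excess n w (inv \<sigma> ` {1..i}))"
proof -
  have inj: "inj_on (inv \<sigma>) X" for X
    using permutes_inj[OF permutes_inv[OF \<sigma>]] by (rule inj_on_subset) simp
  have "weyl_act \<sigma> \<phi> k = complex_of_real (w (inv \<sigma> k))" if "k \<in> {1..n}" for k
    using permutes_in_image[OF permutes_inv[OF \<sigma>], of k] that \<phi> by (simp add: weyl_act_def)
  then have "positive_weight n (weyl_act \<sigma> \<phi>) \<longleftrightarrow>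
    (\<forall>i\<in>{1..<n}. real i * (\<Sum>k=1..n. w (inv \<sigma> k)) < real n * (\<Sum>k=1..i. w (inv \<sigma> k)))"
    by (intro positive_weight_iff_partial_sums n)
  moreover have "(\<Sum>k=1..n. w (inv \<sigma> k)) = (\<Sum>k=1..n. w k)"
    using sum.permute[OF permutes_inv[OF \<sigma>], of w] by (simp add: comp_def)
  ultimately show ?thesis
    by (simp add: excess_def sum.reindex[OF inj] card_image[OF inj] comp_def)
qed

text \<open>The total set has excess zero and excess is additive.\<close>

lemma excess_complement:
  assumes "A \<subseteq> {1..n}"
  shows "excess n w ({1..n} - A) = - excess n w A"
proof -
  have "finite A"
    using assms finite_subset by blast
  moreover have "card A \<le> n"
    using card_mono[OF _ assms] by simp
  ultimately show ?thesis
    using assms by (simp add: excess_def sum_diff card_Diff_subset of_nat_diff algebra_simps)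
qed

text \<open>Each entry at a position in \<open>{1..i}\<close> exceeds each entry at a later one; summing over all these
  pairs gives the claim. For \<open>\<rho> + \<mu>\<close> it yields positivity at the identity, so that the set whose maximum
  is taken contains 0.\<close>

lemma excess_initial_pos:
  assumes w: "\<And>a b. a \<in> {1..n} \<Longrightarrow> b \<in> {1..n} \<Longrightarrow> a < b \<Longrightarrow> w b < w a"
    and i: "i \<in> {1..<n}"
  shows "0 < excess n w {1..i}"
proof -
  have split: "sum w {1..n} = sum w {1..i} + sum w {i<..n}"
    using i by (subst sum.union_disjoint[symmetric]) (auto intro!: sum.cong)
  have "real i * sum w {i<..n} = (\<Sum>a\<in>{1..i}. \<Sum>b\<in>{i<..n}. w b)"
    by simp
  also have "\<dots> < (\<Sum>a\<in>{1..i}. \<Sum>b\<in>{i<..n}. w a)"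
    using i by (intro sum_strict_mono) (auto intro!: w)
  also have "\<dots> = real (n - i) * sum w {1..i}"
    by (simp add: sum_distrib_left)
  finally show ?thesis
    using i unfolding excess_def split by (simp add: of_nat_diff algebra_simps)
qed

section \<open>Length and inversions\<close>

definition inversions :: "nat \<Rightarrow> (nat \<Rightarrow> nat) \<Rightarrow> (nat \<times> nat) set" where
  "inversions n \<sigma> = {(a, b). a \<in> {1..n} \<and> b \<in> {1..n} \<and> a < b \<and> \<sigma> b < \<sigma> a}"

lemma finite_inversions: "finite (inversions n \<sigma>)"
  by (rule finite_subset[of _ "{1..n} \<times> {1..n}"]) (auto simp: inversions_def)

lemma inversions_id: "inversions n (\<lambda>a. a) = {}"
  by (auto simp: inversions_def)

lemma simple_reflection_permutes:
  "j \<in> {1..<n} \<Longrightarrow> simple_reflection j permutes {1..n}"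
  unfolding simple_reflection_def by (rule permutes_swap_id) auto

lemma simple_reflection_involutory [simp]:
  "simple_reflection j (simple_reflection j k) = k"
  by (simp add: simple_reflection_def)

lemma simple_reflection_comp_cancel [simp]:
  "simple_reflection j \<circ> (simple_reflection j \<circ> \<sigma>) = \<sigma>"
  by (simp add: fun_eq_iff)

lemma inv_simple_reflection_comp:
  assumes "\<sigma> permutes S"
  shows "inv (simple_reflection j \<circ> \<sigma>) = inv \<sigma> \<circ> simple_reflection j"
  using o_inv_distrib[of "simple_reflection j" \<sigma>] permutes_bij[OF assms]
  by (simp add: simple_reflection_def)

lemma simple_reflection_less_iff:
  assumes "{u, v} \<noteq> {j, Suc j}"
  shows "simple_reflection j u < simple_reflection j v \<longleftrightarrow> u < v"
  using assms by (auto simp: simple_reflection_def transpose_def)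

text \<open>Left multiplication by \<open>s\<^sub>j\<close> exchanges the adjacent values \<open>j\<close> and \<open>j + 1\<close>. This alters the relative
  order at a single pair of positions, the one where these two values occur.\<close>

lemma card_inversions_ascent:
  assumes \<sigma>: "\<sigma> permutes {1..n}" and j: "j \<in> {1..<n}"
    and asc: "inv \<sigma> j < inv \<sigma> (Suc j)"
  shows "card (inversions n (simple_reflection j \<circ> \<sigma>)) = card (inversions n \<sigma>) + 1"
proof -
  let ?s = "simple_reflection j" and ?a = "inv \<sigma> j" and ?b = "inv \<sigma> (Suc j)"
  have s: "?s j = Suc j" "?s (Suc j) = j"
    by (simp_all add: simple_reflection_def)
  have val: "\<sigma> ?a = j" "\<sigma> ?b = Suc j"
    using permutes_inverses[OF \<sigma>] by auto
  have range: "?a \<in> {1..n}" "?b \<in> {1..n}"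
    using permutes_in_image[OF permutes_inv[OF \<sigma>]] j by auto
  have new: "(?a, ?b) \<notin> inversions n \<sigma>"
    by (simp add: inversions_def val)
  have "(x, y) \<in> inversions n (?s \<circ> \<sigma>) \<longleftrightarrow> (x, y) \<in> insert (?a, ?b) (inversions n \<sigma>)" for x y
  proof (cases "{\<sigma> x, \<sigma> y} = {j, Suc j}")
    case True
    then consider "\<sigma> x = j" "\<sigma> y = Suc j" | "\<sigma> x = Suc j" "\<sigma> y = j"
      by (auto simp: doubleton_eq_iff)
    then show ?thesis
    proof cases
      case 1
      then have "x = ?a" "y = ?b"
        using permutes_inverses(2)[OF \<sigma>] by metis+
      then show ?thesis
        using range asc by (simp add: inversions_def val s)
    next
      case 2
      then have "x = ?b" "y = ?a"
        using permutes_inverses(2)[OF \<sigma>] by metis+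
      then show ?thesis
        using asc by (simp add: inversions_def)
    qed
  next
    case False
    then have "(?s (\<sigma> y) < ?s (\<sigma> x)) = (\<sigma> y < \<sigma> x)"
      by (intro simple_reflection_less_iff) (simp add: insert_commute)
    moreover have "(x, y) \<noteq> (?a, ?b)"
      using False val by auto
    ultimately show ?thesis
      by (auto simp: inversions_def)
  qed
  then have "inversions n (?s \<circ> \<sigma>) = insert (?a, ?b) (inversions n \<sigma>)"
    by auto
  then show ?thesis
    using new by (simp add: finite_inversions)
qed

lemma card_inversions_descent:
  assumes \<sigma>: "\<sigma> permutes {1..n}" and j: "j \<in> {1..<n}"
    and desc: "inv \<sigma> (Suc j) < inv \<sigma> j"
  shows "card (inversions n \<sigma>) = card (inversions n (simple_reflection j \<circ> \<sigma>)) + 1"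
proof -
  have p: "simple_reflection j \<circ> \<sigma> permutes {1..n}"
    using \<sigma> simple_reflection_permutes[OF j] by (rule permutes_compose)
  have asc: "inv (simple_reflection j \<circ> \<sigma>) j < inv (simple_reflection j \<circ> \<sigma>) (Suc j)"
    using desc unfolding inv_simple_reflection_comp[OF \<sigma>]
    by (simp add: simple_reflection_def)
  show ?thesis
    using card_inversions_ascent[OF p j asc] by (simp only: simple_reflection_comp_cancel)
qed

lemma inv_adjacent_neq:
  assumes "\<sigma> permutes S"
  shows "inv \<sigma> j \<noteq> inv \<sigma> (Suc j)"
  by (simp add: inj_eq[OF permutes_inj[OF permutes_inv[OF assms]]])

primrec word :: "nat list \<Rightarrow> nat \<Rightarrow> nat" where
  "word [] = id"
| "word (j # js) = simple_reflection j \<circ> word js"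

lemma weyl_length_eq_Least_word:
  "weyl_length n \<sigma> = (LEAST k. \<exists>is. length is = k \<and> set is \<subseteq> {1..<n} \<and> \<sigma> = word is)"
proof -
  have "foldr (\<circ>) (map simple_reflection is) id = word is" for "is"
    by (induction "is") auto
  then show ?thesis
    by (simp add: weyl_length_def)
qed

lemma word_permutes: "set is \<subseteq> {1..<n} \<Longrightarrow> word is permutes {1..n}"
proof (induction "is")
  case Nil
  then show ?case using permutes_id[of "{1..n}"] by (simp add: id_def)
next
  case (Cons j js)
  then have "simple_reflection j permutes {1..n}" "word js permutes {1..n}"
    using simple_reflection_permutes[of j n] by auto
  then have "simple_reflection j \<circ> word js permutes {1..n}"
    by (rule permutes_compose[rotated])
  then show ?case by (simp only: word.simps)
qed

lemma card_inversions_word_le: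
  "set is \<subseteq> {1..<n} \<Longrightarrow> card (inversions n (word is)) \<le> length is"
proof (induction "is")
  case Nil
  then show ?case by (simp add: inversions_id id_def)
next
  case (Cons j js)
  have p: "word js permutes {1..n}" and j: "j \<in> {1..<n}"
    using Cons.prems word_permutes[of js n] by auto
  have "card (inversions n (simple_reflection j \<circ> word js)) \<le> card (inversions n (word js)) + 1"
    using card_inversions_ascent[OF p j] card_inversions_descent[OF p j]
      inv_adjacent_neq[OF p, of j] by linarith
  then have "card (inversions n (simple_reflection j \<circ> word js)) \<le> length js + 1"
    using Cons by simp
  then show ?case
    by (simp only: word.simps list.size add_0_right plus_1_eq_Suc)
qed

text \<open>The inverse is strictly increasing on \<open>{1..n}\<close>, hence nowhere below the identity.\<close>

lemma permutes_no_descent_imp_id: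
  assumes \<sigma>: "\<sigma> permutes {1..n}"
    and asc: "\<And>j. j \<in> {1..<n} \<Longrightarrow> inv \<sigma> j < inv \<sigma> (Suc j)"
  shows "\<sigma> = id"
proof -
  have p: "inv \<sigma> permutes {1..n}"
    using \<sigma> by (rule permutes_inv)
  have "i \<le> inv \<sigma> i" if "i \<ge> 1" "i \<le> n" for i
    using that
  proof (induction i rule: nat_induct_at_least)
    case base
    then show ?case
      using permutes_in_image[OF p, of 1] by auto
  next
    case (Suc i)
    then show ?case
      using asc[of i] by auto
  qed
  then have "inv \<sigma> = id"
    using permutes_natset_ge[OF p] by simp
  then show ?thesis
    using permutes_inv_inv[OF \<sigma>] by simp
qed

text \<open>Bubble sort: as long as there is a descent, removing it costs one letter and one inversion.\<close>

lemma exists_word_of_length_inversions: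
  "\<sigma> permutes {1..n} \<Longrightarrow>
    \<exists>is. length is = card (inversions n \<sigma>) \<and> set is \<subseteq> {1..<n} \<and> \<sigma> = word is"
proof (induction "card (inversions n \<sigma>)" arbitrary: \<sigma> rule: less_induct)
  case less
  show ?case
  proof (cases "\<exists>j\<in>{1..<n}. inv \<sigma> (Suc j) < inv \<sigma> j")
    case True
    then obtain j where j: "j \<in> {1..<n}" and desc: "inv \<sigma> (Suc j) < inv \<sigma> j"
      by blast
    let ?\<tau> = "simple_reflection j \<circ> \<sigma>"
    have card: "card (inversions n \<sigma>) = card (inversions n ?\<tau>) + 1"
      by (rule card_inversions_descent[OF less.prems j desc])
    have "?\<tau> permutes {1..n}"
      using less.prems simple_reflection_permutes[OF j] by (rule permutes_compose)
    then obtain js where js: "length js = card (inversions n ?\<tau>)" "set js \<subseteq> {1..<n}"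
        "?\<tau> = word js"
      using less.hyps[of ?\<tau>] card by auto
    have "\<sigma> = simple_reflection j \<circ> word js"
      by (simp flip: js(3))
    then show ?thesis
      using js j card by (intro exI[of _ "j # js"]) auto
  next
    case False
    then have "\<sigma> = id"
      using inv_adjacent_neq[OF less.prems]
      by (intro permutes_no_descent_imp_id[OF less.prems]) (meson linorder_neqE_nat)
    then show ?thesis
      by (intro exI[of _ "[]"]) (simp add: inversions_id id_def)
  qed
qed

lemma weyl_length_le_word:
  "set is \<subseteq> {1..<n} \<Longrightarrow> weyl_length n (word is) \<le> length is"
  unfolding weyl_length_eq_Least_word by (rule Least_le) blast

lemma weyl_length_eq_card_inversions:
  assumes "\<sigma> permutes {1..n}"
  shows "weyl_length n \<sigma> = card (inversions n \<sigma>)"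
  unfolding weyl_length_eq_Least_word
  by (rule Least_equality)
    (use exists_word_of_length_inversions[OF assms] card_inversions_word_le in auto)

lemma obtain_reduced_word:
  assumes "\<sigma> permutes {1..n}"
  obtains "is" where "set is \<subseteq> {1..<n}" "\<sigma> = word is" "length is = weyl_length n \<sigma>"
  using exists_word_of_length_inversions[OF assms] weyl_length_eq_card_inversions[OF assms]
  by auto

lemma longest_element_permutes: "longest_element n permutes {1..n}"
  and weyl_length_le_longest:
    "\<sigma> permutes {1..n} \<Longrightarrow> weyl_length n \<sigma> \<le> weyl_length n (longest_element n)"
proof -
  have bound: "weyl_length n \<tau> < n * n + 1" if "\<tau> \<in> weyl_group n" for \<tau>
  proof -
    have "card (inversions n \<tau>) \<le> card ({1..n} \<times> {1..n})"
      by (rule card_mono) (auto simp: inversions_def)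
    then show ?thesis
      using that by (simp add: weyl_group_def weyl_length_eq_card_inversions)
  qed
  have "id \<in> weyl_group n"
    by (simp add: weyl_group_def permutes_id)
  then have "longest_element n \<in> weyl_group n \<and>
      (\<forall>\<tau>. \<tau> \<in> weyl_group n \<longrightarrow> weyl_length n \<tau> \<le> weyl_length n (longest_element n))"
    unfolding longest_element_def arg_max_on_def
    by (rule arg_max_nat_lemma[of "\<lambda>\<tau>. \<tau> \<in> weyl_group n"]) (use bound in blast)
  then show "longest_element n permutes {1..n}"
    and "\<sigma> permutes {1..n} \<Longrightarrow> weyl_length n \<sigma> \<le> weyl_length n (longest_element n)"
    by (simp_all add: weyl_group_def)
qed

text \<open>Without an ascent every pair of positions would be an inversion of \<open>\<sigma>\<close>, so that no element could
  be longer.\<close>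

lemma exists_ascent_below_longest:
  assumes \<sigma>: "\<sigma> permutes {1..n}"
    and less: "weyl_length n \<sigma> < weyl_length n \<tau>" and \<tau>: "\<tau> permutes {1..n}"
  shows "\<exists>j\<in>{1..<n}. inv \<sigma> j < inv \<sigma> (Suc j)"
proof (rule ccontr)
  assume "\<not> ?thesis"
  then have desc: "inv \<sigma> (Suc j) < inv \<sigma> j" if "j \<in> {1..<n}" for j
    using inv_adjacent_neq[OF \<sigma>] that by (meson linorder_neqE_nat)
  have anti: "inv \<sigma> y < inv \<sigma> x" if "x \<ge> 1" "x < y" "y \<le> n" for x y
    using Suc_leI[OF that(2)] that(3)
  proof (induction y rule: dec_induct)
    case base
    then show ?case
      using desc[of x] that(1) by simp
  next
    case (step y)
    then show ?case
      using desc[of y] that(1) by simp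
  qed
  have "inversions n \<tau> \<subseteq> inversions n \<sigma>"
  proof clarify
    fix a b assume ab: "(a, b) \<in> inversions n \<tau>"
    then have r: "a \<in> {1..n}" "b \<in> {1..n}" "a < b"
      by (auto simp: inversions_def)
    have "\<sigma> a \<in> {1..n}" "\<sigma> b \<in> {1..n}"
      using r permutes_in_image[OF \<sigma>] by auto
    moreover have "inv \<sigma> (\<sigma> a) = a" "inv \<sigma> (\<sigma> b) = b"
      using permutes_inverses(2)[OF \<sigma>] by auto
    ultimately have "\<not> \<sigma> a < \<sigma> b"
      using anti[of "\<sigma> a" "\<sigma> b"] r by auto
    moreover have "\<sigma> a \<noteq> \<sigma> b"
      using inj_eq[OF permutes_inj[OF \<sigma>]] r by simp
    ultimately show "(a, b) \<in> inversions n \<sigma>"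
      using r by (simp add: inversions_def)
  qed
  then have "card (inversions n \<tau>) \<le> card (inversions n \<sigma>)"
    by (intro card_mono finite_inversions)
  then show False
    using less
    unfolding weyl_length_eq_card_inversions[OF \<sigma>] weyl_length_eq_card_inversions[OF \<tau>] by simp
qed

text \<open>A simple reflection lowers only the element \<open>j + 1\<close>, and only by one.\<close>

lemma sum_le_sum_image_word:
  assumes "set is \<subseteq> {1..<n}" "finite A"
  shows "\<Sum>A \<le> \<Sum>(word is ` A) + length is"
  using assms(1)
proof (induction "is")
  case Nil
  then show ?case by simp
next
  case (Cons j js)
  let ?B = "word js ` A" and ?s = "simple_reflection j"
  have fin: "finite ?B"
    using assms(2) by simp
  have "\<Sum>?B \<le> (\<Sum>x\<in>?B. ?s x + (if x = j + 1 then 1 else 0))"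
    by (rule sum_mono) (auto simp: simple_reflection_def transpose_def)
  also have "\<dots> \<le> (\<Sum>x\<in>?B. ?s x) + 1"
    using fin by (simp add: sum.distrib sum.delta)
  also have "(\<Sum>x\<in>?B. ?s x) = \<Sum>(?s ` ?B)"
    by (subst sum.reindex) (auto intro: inj_on_inverseI[of _ ?s])
  finally show ?case
    using Cons by (simp add: image_comp)
qed

lemma sum_inv_image_le:
  assumes \<sigma>: "\<sigma> permutes {1..n}"
  shows "\<Sum>(inv \<sigma> ` {1..i}) \<le> \<Sum>{1..i} + weyl_length n \<sigma>"
proof -
  obtain "is" where "set is \<subseteq> {1..<n}" "\<sigma> = word is" "length is = weyl_length n \<sigma>"
    using obtain_reduced_word[OF \<sigma>] .
  moreover have "\<sigma> ` inv \<sigma> ` {1..i} = {1..i}"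
    by (simp add: image_image permutes_inverses(1)[OF \<sigma>])
  ultimately show ?thesis
    using sum_le_sum_image_word[of "is" n "inv \<sigma> ` {1..i}"] by simp
qed

section \<open>Crossings\<close>

definition crossings :: "nat set \<Rightarrow> (nat \<times> nat) set" where
  "crossings A = {(x, y). 1 \<le> x \<and> x < y \<and> x \<notin> A \<and> y \<in> A}"

lemma finite_crossings:
  assumes "finite A"
  shows "finite (crossings A)"
  by (rule finite_subset[of _ "(SIGMA y:A. {..<y})\<inverse>"])
    (use assms in \<open>auto simp: crossings_def\<close>)

text \<open>Crossings measure how far \<open>A\<close> is from the initial segment of the same size. An element \<open>y\<close> added
  above \<open>A\<close> creates one crossing for each of the \<open>y - 1 - |A|\<close> smaller positive numbers outside \<open>A\<close>.\<close>

lemma crossings_sum: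
  assumes "finite A" "0 \<notin> A"
  shows "card A * (card A + 1) + 2 * card (crossings A) = 2 * \<Sum>A"
  using assms
proof (induction A rule: finite_linorder_max_induct)
  case empty
  then show ?case by (simp add: crossings_def)
next
  case (insert y A)
  let ?X = "{1..<y} - A"
  have A: "A \<subseteq> {1..<y}" "y \<notin> A"
    using insert.hyps insert.prems by (auto simp: Suc_le_eq intro: gr0I)
  have "crossings (insert y A) = crossings A \<union> (\<lambda>x. (x, y)) ` ?X"
    using insert.hyps(2) by (auto simp: crossings_def)
  moreover have "crossings A \<inter> (\<lambda>x. (x, y)) ` ?X = {}"
    using A by (auto simp: crossings_def)
  ultimately have "card (crossings (insert y A)) = card (crossings A) + card ?X"
    using finite_crossings[OF insert.hyps(1)]
    by (simp add: card_Un_disjoint card_image inj_on_def)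
  moreover have "card ?X + card A = y - 1"
    using A insert.hyps(1) card_mono[OF _ A(1)] by (simp add: card_Diff_subset)
  moreover have "y \<ge> 1"
    using insert.prems by (cases y) auto
  ultimately show ?case
    using insert A by (simp add: algebra_simps)
qed

text \<open>Fix an absent \<open>x0\<close> in the initial segment and a present \<open>y0\<close> in the final one. Each other absent
  number of the initial segment crosses with \<open>y0\<close>, each present number of the final segment crosses with
  \<open>x0\<close>, and each number between the segments crosses with \<open>x0\<close> or \<open>y0\<close>, according to whether it is
  present. These crossings are distinct.\<close>

lemma crossings_ge:
  assumes A: "finite A" and c: "c + c' \<le> n"
    and x0: "x0 \<in> {1..c} - A" and y0: "y0 \<in> A \<inter> {n - c'<..n}"
  shows "card ({1..c} - A) + card (A \<inter> {n - c'<..n}) + (n - c - c') \<le> card (crossings A) + 1"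
proof -
  let ?P = "{1..c} - A" and ?Q = "A \<inter> {n - c'<..n}" and ?M = "{c<..n - c'}"
  \<comment> \<open>Both \<open>x0\<close> and \<open>y0\<close> are sent to the crossing \<open>(x0, y0)\<close>; hence \<open>x0\<close> is left out of the domain.\<close>
  define h where "h z = (if z \<in> A then (x0, z) else (z, y0))" for z
  have "card (?P \<union> ?Q \<union> ?M) = card (?P \<union> ?Q) + card ?M"
    using c by (intro card_Un_disjoint) auto
  moreover have "card (?P \<union> ?Q) = card ?P + card ?Q"
    using c by (intro card_Un_disjoint) auto
  ultimately have "card (?P \<union> ?Q \<union> ?M) = card ?P + card ?Q + (n - c - c')"
    by simp
  moreover have "card (?P \<union> ?Q \<union> ?M - {x0}) = card (?P \<union> ?Q \<union> ?M) - 1"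
    using x0 by (intro card_Diff_singleton) auto
  moreover have "card (?P \<union> ?Q \<union> ?M - {x0}) \<le> card (crossings A)"
  proof (rule card_inj_on_le[where f = h])
    show "inj_on h (?P \<union> ?Q \<union> ?M - {x0})"
      by (auto simp: inj_on_def h_def)
    show "h ` (?P \<union> ?Q \<union> ?M - {x0}) \<subseteq> crossings A"
      using x0 y0 c by (auto simp: h_def crossings_def)
    show "finite (crossings A)"
      using A by (rule finite_crossings)
  qed
  ultimately show ?thesis
    by linarith
qed

text \<open>Let \<open>p\<close> count the absent numbers in the initial segment and \<open>q\<close> the present ones in the final segment.
  If both are positive, the previous bound yields \<open>p + q + n - c - c' \<le> n div 2\<close>. Since \<open>c\<close> and \<open>c'\<close> are at
  most \<open>n div 2\<close>, this gives \<open>p + q \<le> c\<close> and \<open>p + q \<le> c'\<close>: at least \<open>q\<close> numbers are present in the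
  initial segment and at least \<open>p\<close> are absent from the final one. So the ratio of present to absent numbers
  is at least \<open>q / p\<close> in the former and at most \<open>q / p\<close> in the latter.\<close>

lemma prefix_density_ge_suffix_density:
  assumes A: "finite A" and few: "card (crossings A) < n div 2"
    and c: "c \<le> n div 2" and c': "c' \<le> n div 2"
  shows "card (A \<inter> {n - c'<..n}) * c \<le> card (A \<inter> {1..c}) * c'"
proof -
  let ?P = "{1..c} - A" and ?Q = "A \<inter> {n - c'<..n}"
  have split: "card (A \<inter> {1..c}) + card ?P = c"
    using card_Int_Diff[of "{1..c}" A] by (simp add: Int_commute)
  have Q: "card ?Q \<le> c'"
    using card_mono[of "{n - c'<..n}" ?Q] c' by simp
  show ?thesis
  proof (cases "?P = {} \<or> ?Q = {}")
    case True
    then show ?thesis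
    proof
      assume "?P = {}"
      then have "card (A \<inter> {1..c}) = c"
        using split by (metis add.right_neutral card.empty)
      then show ?thesis
        using mult_le_mono1[OF Q, of c] by (simp add: mult.commute)
    next
      assume "?Q = {}"
      then show ?thesis by (metis card.empty mult_0 zero_le)
    qed
  next
    case False
    then obtain x0 y0 where "x0 \<in> ?P" "y0 \<in> ?Q"
      by blast
    then have "card ?P + card ?Q + (n - c - c') \<le> card (crossings A) + 1"
      using A c c' by (intro crossings_ge) auto
    then have 1: "card ?Q \<le> card (A \<inter> {1..c})" and 2: "card ?P \<le> c' - card ?Q"
      using few c c' split by linarith+
    have "card ?Q * c = card ?Q * card (A \<inter> {1..c}) + card ?Q * card ?P"
      using split by (metis add_mult_distrib2)
    also have "\<dots> \<le> card ?Q * card (A \<inter> {1..c}) + card (A \<inter> {1..c}) * (c' - card ?Q)"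
      using mult_le_mono[OF 1 2] by simp
    also have "\<dots> = card (A \<inter> {1..c}) * c'"
      using Q by (metis add_mult_distrib2 le_add_diff_inverse mult.commute)
    finally show ?thesis .
  qed
qed

text \<open>The greatest density of a final segment serves as slope. The empty segment, whose density is
  \<open>0 / 0 = 0\<close>, is included so that the maximum is over a nonempty set.\<close>

lemma exists_separating_slope:
  assumes A: "finite A" and few: "card (crossings A) < n div 2"
  obtains \<theta> :: real where "0 \<le> \<theta>" "\<theta> \<le> 1"
    "\<And>c. c \<le> n div 2 \<Longrightarrow> \<theta> * real c \<le> real (card (A \<inter> {1..c}))"
    "\<And>c. c \<le> n div 2 \<Longrightarrow> real (card (A \<inter> {n - c<..n})) \<le> \<theta> * real c"
proof -
  let ?g = "\<lambda>c. card (A \<inter> {n - c<..n})"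
  define D where "D = (\<lambda>c. real (?g c) / real c) ` {0..n div 2}"
  define \<theta> where "\<theta> = Max D"
  have fin: "finite D" "D \<noteq> {}"
    by (auto simp: D_def)
  have g: "?g c \<le> c" if "c \<le> n div 2" for c
    using card_mono[of "{n - c<..n}" "A \<inter> {n - c<..n}"] that by simp
  have ge: "real (?g c) / real c \<le> \<theta>" if "c \<le> n div 2" for c
    unfolding \<theta>_def using that fin by (intro Max_ge) (auto simp: D_def)
  have "\<theta> \<in> D"
    unfolding \<theta>_def using fin by (rule Max_in)
  then obtain c' where c': "c' \<le> n div 2" "\<theta> = real (?g c') / real c'"
    by (auto simp: D_def)
  show ?thesis
  proof
    show "0 \<le> \<theta>" "\<theta> \<le> 1"
      using c' g[of c'] by (auto simp: divide_le_eq_1)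
  next
    fix c assume c: "c \<le> n div 2"
    show "\<theta> * real c \<le> real (card (A \<inter> {1..c}))"
    proof (cases "c' = 0")
      case False
      have "real (?g c') * real c \<le> real (card (A \<inter> {1..c})) * real c'"
        using prefix_density_ge_suffix_density[OF A few c c'(1)]
        by (metis of_nat_le_iff of_nat_mult)
      then show ?thesis
        using False by (simp add: c'(2) field_simps)
    qed (simp add: c'(2))
    show "real (?g c) \<le> \<theta> * real c"
      using ge[OF c] by (cases "c = 0") (auto simp: field_simps)
  qed
qed

section \<open>The weight of a bipartition\<close>

lemma part_antimono:
  assumes p: "partition p" and "1 \<le> a" "a \<le> b"
  shows "part p b \<le> part p a"
proof (cases "b \<le> length p \<and> a < b")
  case True
  then have "p ! (a - 1) \<ge> p ! (b - 1)"
    using p assms(2) by (intro sorted_wrt_nth_less[of "(\<ge>)"]) (auto simp: partition_def)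
  then show ?thesis
    using True assms by (simp add: part_def)
qed (use assms in \<open>auto simp: part_def\<close>)

lemma sum_highest_weight:
  fixes u :: "nat \<Rightarrow> real"
  assumes n: "n \<ge> bilength l"
  shows "(\<Sum>a=1..n. u a * real_of_int (highest_weight n l a)) =
    (\<Sum>a=1..plength (fst l). u a * real (part (fst l) a))
    - (\<Sum>b=1..plength (snd l). u (n + 1 - b) * real (part (snd l) b))"
proof -
  let ?L = "plength (fst l)" and ?M = "plength (snd l)"
  let ?f = "\<lambda>a. u a * real_of_int (highest_weight n l a)"
  have LM: "?L + ?M \<le> n"
    using n by (simp add: bilength_def)
  have split: "{1..n} = {1..?L} \<union> {?L<..n - ?M} \<union> {n - ?M<..n}"
    using LM by auto
  have "sum ?f {1..n} = sum ?f {1..?L} + sum ?f {?L<..n - ?M} + sum ?f {n - ?M<..n}"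
    using LM by (subst split, subst sum.union_disjoint, auto, subst sum.union_disjoint, auto)
  moreover have "sum ?f {1..?L} = (\<Sum>a=1..?L. u a * real (part (fst l) a))"
    by (intro sum.cong) (auto simp: highest_weight_def)
  moreover have "sum ?f {?L<..n - ?M} = 0"
    by (intro sum.neutral) (auto simp: highest_weight_def)
  moreover have "sum ?f {n - ?M<..n} = (\<Sum>b=1..?M. - (u (n + 1 - b) * real (part (snd l) b)))"
    by (rule sum.reindex_bij_witness[of _ "\<lambda>b. n + 1 - b" "\<lambda>a. n + 1 - a"])
      (use LM in \<open>auto simp: highest_weight_def\<close>)
  ultimately show ?thesis
    by (simp add: sum_negf)
qed

lemma sum_highest_weight_total:
  assumes "n \<ge> bilength l"
  shows "(\<Sum>a=1..n. real_of_int (highest_weight n l a)) = real_of_int (bidegree l)"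
  using sum_highest_weight[OF assms, of "\<lambda>_. 1"] by (simp add: bidegree_def psize_def)

lemma highest_weight_antimono:
  assumes l: "bipartition l" and n: "n \<ge> bilength l"
    and ab: "a \<in> {1..n}" "b \<in> {1..n}" "a < b"
  shows "highest_weight n l b \<le> highest_weight n l a"
proof -
  have "partition (fst l)" "partition (snd l)"
    using l by (auto simp: bipartition_def)
  then show ?thesis
    using ab n part_antimono[of "fst l" a b] part_antimono[of "snd l" "n + 1 - b" "n + 1 - a"]
    by (auto simp: highest_weight_def bilength_def)
qed

definition shifted_weight :: "nat \<Rightarrow> bipart \<Rightarrow> nat \<Rightarrow> real" where
  "shifted_weight n l k = (real n + 1) / 2 - real k + real_of_int (highest_weight n l k)"

lemma rho_eq:
  assumes k: "k \<in> {1..n}"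
  shows "rho n k = complex_of_real ((real n + 1) / 2 - real k)"
proof -
  have inner: "(\<Sum>i\<in>{1..<j}. L_weight i k - L_weight j k) =
      (if k < j then 1 else 0) - (if j = k then of_nat (k - 1) else 0)" for j
    using k by (auto simp: sum_subtractf L_weight_def sum.delta' of_nat_diff)
  have "{j \<in> {1..n}. k < j} = {k<..n}"
    by auto
  then have "(\<Sum>j=1..n. \<Sum>i\<in>{1..<j}. L_weight i k - L_weight j k) =
      of_nat (n - k) - of_nat (k - 1)"
    using k unfolding inner
    by (simp add: sum_subtractf[of "\<lambda>j. if k < j then 1 else 0"] of_nat_diff flip: sum.inter_filter)
  then show ?thesis
    using k by (simp add: rho_def of_nat_diff field_simps)
qed

lemma rho_plus_mu_eq:
  "k \<in> {1..n} \<Longrightarrow> rho_plus_mu n l k = complex_of_real (shifted_weight n l k)"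
  by (simp add: rho_plus_mu_def rho_eq shifted_weight_def)

lemma shifted_weight_strict_antimono:
  assumes "bipartition l" "n \<ge> bilength l" "a \<in> {1..n}" "b \<in> {1..n}" "a < b"
  shows "shifted_weight n l b < shifted_weight n l a"
  using highest_weight_antimono[OF assms] assms(5) by (simp add: shifted_weight_def)

text \<open>Summation by parts: by induction, the sum up to \<open>c\<close> is at least \<open>x c\<close> times the partial sum of
  \<open>u\<close>, as lowering the factor \<open>x c\<close> to \<open>x (c + 1)\<close> can only decrease the bound.\<close>

lemma abel_sum_nonneg:
  fixes u x :: "nat \<Rightarrow> real"
  assumes x: "\<And>a. 1 \<le> a \<Longrightarrow> a < L \<Longrightarrow> x (a + 1) \<le> x a" "x L \<ge> 0"
    and u: "\<And>c. c \<le> L \<Longrightarrow> 0 \<le> (\<Sum>a=1..c. u a)"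
  shows "0 \<le> (\<Sum>a=1..L. u a * x a)"
proof -
  have "x c * (\<Sum>a=1..c. u a) \<le> (\<Sum>a=1..c. u a * x a)" if "c \<le> L" for c
    using that
  proof (induction c)
    case (Suc c)
    have "x (c + 1) * (\<Sum>a=1..c. u a) \<le> x c * (\<Sum>a=1..c. u a)"
      using x(1)[of c] u[of c] Suc.prems by (cases "c = 0") (auto intro: mult_right_mono)
    then show ?case
      using Suc by (simp add: algebra_simps)
  qed simp
  from this[of L] show ?thesis
    using mult_nonneg_nonneg[OF x(2) u[of L]] by simp
qed

text \<open>Weight each position by its indicator in \<open>A\<close> minus \<open>\<theta>\<close>. The density assumptions say that these weights
  have nonnegative partial sums from the left end and nonpositive ones from the right end, where
  \<open>\<lambda>\<close> and \<open>\<lambda>'\<close> live; summation by parts applies to each partition.\<close>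

lemma highest_weight_sum_ge_slope:
  assumes l: "bipartition l" and n: "n \<ge> bilength l" and A: "A \<subseteq> {1..n}"
    and pre: "\<And>c. c \<le> plength (fst l) \<Longrightarrow> \<theta> * real c \<le> real (card (A \<inter> {1..c}))"
    and suf: "\<And>c. c \<le> plength (snd l) \<Longrightarrow> real (card (A \<inter> {n - c<..n})) \<le> \<theta> * real c"
  shows "\<theta> * real_of_int (bidegree l) \<le> (\<Sum>a\<in>A. real_of_int (highest_weight n l a))"
proof -
  let ?L = "plength (fst l)" and ?M = "plength (snd l)"
  let ?h = "\<lambda>a. real_of_int (highest_weight n l a)"
  let ?u = "\<lambda>a. of_bool (a \<in> A) - \<theta>"
  have part: "partition (fst l)" "partition (snd l)"
    using l by (auto simp: bipartition_def)
  have "(\<Sum>a\<in>A. ?h a) - \<theta> * real_of_int (bidegree l) = (\<Sum>a=1..n. ?u a * ?h a)"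
    unfolding left_diff_distrib sum_subtractf
    using A by (simp add: sum_of_bool_mult_eq Int_absorb1
        flip: sum_highest_weight_total[OF n] sum_distrib_left)
  also have "\<dots> = (\<Sum>a=1..?L. ?u a * real (part (fst l) a))
      + (\<Sum>b=1..?M. - ?u (n + 1 - b) * real (part (snd l) b))"
    by (simp only: sum_highest_weight[OF n] mult_minus_left sum_negf diff_conv_add_uminus)
  also have "\<dots> \<ge> 0"
  proof (intro add_nonneg_nonneg abel_sum_nonneg)
    fix c assume c: "c \<le> ?L"
    have "(\<Sum>a=1..c. of_bool (a \<in> A) :: real) = real (card (A \<inter> {1..c}))"
      by (simp add: sum_of_bool_eq Int_commute)
    then show "0 \<le> (\<Sum>a=1..c. ?u a)"
      using pre[OF c] by (simp add: sum_subtractf mult.commute)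
  next
    fix c assume c: "c \<le> ?M"
    then have cn: "c \<le> n"
      using n by (simp add: bilength_def)
    have "(\<Sum>b=1..c. of_bool (n + 1 - b \<in> A) :: real) = (\<Sum>a\<in>{n - c<..n}. of_bool (a \<in> A))"
      by (rule sum.reindex_bij_witness[of _ "\<lambda>b. n + 1 - b" "\<lambda>a. n + 1 - a"]) (use cn in auto)
    also have "\<dots> = real (card (A \<inter> {n - c<..n}))"
      by (simp add: sum_of_bool_eq Int_commute)
    finally show "0 \<le> (\<Sum>b=1..c. - ?u (n + 1 - b))"
      using suf[OF c] by (simp add: sum_subtractf mult.commute)
  qed (use part in \<open>auto intro: part_antimono\<close>)
  finally show ?thesis
    by simp
qed

section \<open>Few crossings force positivity\<close>

text \<open>The first summand on the left is the contribution of \<open>\<rho>\<close>, where crossings enter through the sum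
  of \<open>A\<close>; the second bounds the contribution of \<open>\<mu>\<close>.\<close>

lemma excess_shifted_weight_ge:
  assumes n: "n \<ge> bilength l" and A: "A \<subseteq> {1..n}"
    and \<theta>: "\<theta> * real_of_int (bidegree l) \<le> (\<Sum>a\<in>A. real_of_int (highest_weight n l a))"
  shows "real n * (real (card A) * (real n - real (card A)) / 2 - real (card (crossings A)))
      + (real n * \<theta> - real (card A)) * real_of_int (bidegree l)
    \<le> excess n (shifted_weight n l) A"
proof -
  have fin: "finite A" "0 \<notin> A"
    using A finite_subset by auto
  have "real (2 * \<Sum>A) = real (card A * (card A + 1) + 2 * card (crossings A))"
    by (simp only: crossings_sum[OF fin])
  then have cr: "(\<Sum>a\<in>A. real a) = real (card A) * (real (card A) + 1) / 2 + real (card (crossings A))"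
    by (simp add: field_simps)
  have tot: "(\<Sum>k=1..n. shifted_weight n l k) = real_of_int (bidegree l)"
  proof -
    have "2 * (\<Sum>k=1..n. real k) = real n * (real n + 1)"
      by (induction n) (auto simp: algebra_simps)
    then have "(\<Sum>k=1..n. (real n + 1) / 2 - real k) = 0"
      unfolding sum_subtractf by (simp add: algebra_simps)
    then show ?thesis
      unfolding shifted_weight_def sum.distrib sum_highest_weight_total[OF n] by simp
  qed
  have "excess n (shifted_weight n l) A =
      real n * (real (card A) * (real n - real (card A)) / 2 - real (card (crossings A)))
      + real n * (\<Sum>a\<in>A. real_of_int (highest_weight n l a))
      - real (card A) * real_of_int (bidegree l)"
    unfolding excess_def tot unfolding shifted_weight_def sum.distrib sum_subtractf cr
    by (simp add: field_simps)
  then show ?thesis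
    using mult_left_mono[OF \<theta>, of "real n"] by (simp add: algebra_simps)
qed

text \<open>The bound \<open>B\<close> on the contribution of \<open>\<rho>\<close> beats the error of the slope: the degree is at most
  \<open>(n - 1)/2\<close> in absolute value, strictly less than \<open>n/2\<close>.\<close>

lemma excess_pos_of_slope:
  assumes n: "n \<ge> bilength l" "n \<ge> 1" and A: "A \<subseteq> {1..n}"
    and \<theta>: "\<theta> * real_of_int (bidegree l) \<le> (\<Sum>a\<in>A. real_of_int (highest_weight n l a))"
    and d: "2 * \<bar>bidegree l\<bar> + 1 \<le> int n"
    and B: "0 < B" "\<bar>real n * \<theta> - real (card A)\<bar> \<le> 2 * B"
      "B \<le> real (card A) * (real n - real (card A)) / 2 - real (card (crossings A))"
  shows "0 < excess n (shifted_weight n l) A"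
proof -
  let ?d = "real_of_int (bidegree l)" and ?t = "real n * \<theta> - real (card A)"
  have "real_of_int (2 * \<bar>bidegree l\<bar> + 1) \<le> real_of_int (int n)"
    using d by (simp only: of_int_le_iff)
  then have d': "2 * \<bar>?d\<bar> \<le> real n - 1"
    by simp
  have "\<bar>?t * ?d\<bar> \<le> (2 * B) * \<bar>?d\<bar>"
    unfolding abs_mult using B by (intro mult_right_mono) auto
  also have "\<dots> = B * (2 * \<bar>?d\<bar>)"
    by simp
  also have "\<dots> \<le> B * (real n - 1)"
    using d' B by (intro mult_left_mono) auto
  also have "\<dots> < B * real n"
    using B by simp
  finally have "0 < real n * B + ?t * ?d"
    by (simp add: mult.commute abs_less_iff)
  also have "\<dots> \<le> real n * (real (card A) * (real n - real (card A)) / 2 - real (card (crossings A)))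
      + ?t * ?d"
    using B by (intro add_right_mono mult_left_mono) auto
  also have "\<dots> \<le> excess n (shifted_weight n l) A"
    by (rule excess_shifted_weight_ge[OF n(1) A \<theta>])
  finally show ?thesis .
qed

text \<open>For \<open>2 \<le> |A| \<le> n - 2\<close> the contribution of \<open>\<rho>\<close> is large enough for every slope in \<open>[0, 1]\<close>, so any
  separating slope will do. For singletons and their complements it can be as small as \<open>1/2\<close>, so the slope
  is chosen within \<open>1/n\<close> of \<open>|A|/n\<close>. The slope 0 works for a singleton, which lies in the lower half, where
  \<open>\<lambda>'\<close> contributes nothing; the slope 1 works for the complement of a singleton, as the missing position
  lies in the upper half, where \<open>\<lambda>\<close> contributes nothing.\<close>

lemma excess_pos_of_few_crossings:
  assumes l: "bipartition l" and n: "n \<ge> bilength l" and nB: "int n \<ge> n_B l"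
    and A: "A \<subseteq> {1..n}" "1 \<le> card A" "card A < n"
    and few: "card (crossings A) < n div 2"
  shows "0 < excess n (shifted_weight n l) A"
proof -
  have d: "2 * \<bar>bidegree l\<bar> + 1 \<le> int n"
    and "2 * int (plength (fst l)) \<le> int n" "2 * int (plength (snd l)) \<le> int n"
    using nB by (auto simp: n_B_def)
  then have L: "plength (fst l) \<le> n div 2" and M: "plength (snd l) \<le> n div 2"
    by linarith+
  have fin: "finite A" "0 \<notin> A"
    using A finite_subset by auto
  let ?i = "real (card A)" and ?k = "real (card (crossings A))"
  have k: "2 * ?k \<le> real n - 2"
    using few by linarith
  have cr: "card A * (card A + 1) + 2 * card (crossings A) = 2 * \<Sum>A"
    by (rule crossings_sum[OF fin])
  consider "card A = 1" | "card A = n - 1" | "2 \<le> card A" "card A \<le> n - 2"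
    using A by linarith
  then show ?thesis
  proof cases
    case 1
    then obtain a where a: "A = {a}"
      by (auto simp: card_1_singleton_iff)
    then have "a \<le> n div 2"
      using cr few by simp
    then have "A \<inter> {n - c<..n} = {}" if "c \<le> plength (snd l)" for c
      using a M that by auto
    then have "0 * real_of_int (bidegree l) \<le> (\<Sum>a\<in>A. real_of_int (highest_weight n l a))"
      by (intro highest_weight_sum_ge_slope l n A(1)) auto
    then show ?thesis
      using n A(1) d
      by (intro excess_pos_of_slope[where B = "1/2" and \<theta> = 0])
        (use k A 1 in \<open>auto simp: field_simps\<close>)
  next
    case 2
    have "card ({1..n} - A) = 1"
      using A 2 fin by (simp add: card_Diff_subset)
    then obtain a where a: "{1..n} - A = {a}"
      by (auto simp: card_1_singleton_iff)
    then have Aeq: "A = {1..n} - {a}" and an: "a \<in> {1..n}"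
      using A by blast+
    have "\<Sum>A + a = \<Sum>{1..n}"
      unfolding Aeq using sum.remove[of "{1..n}" a id] an by simp
    moreover have "2 * \<Sum>{1..n} = n * (n + 1)"
      by (induction n) auto
    ultimately have "(n - 1) * n + 2 * card (crossings A) + 2 * a = n * (n + 1)"
      using cr 2 A by simp
    moreover have "n * (n + 1) = (n - 1) * n + 2 * n"
      by (cases n) auto
    ultimately have "a > n div 2"
      using few by linarith
    then have "A \<inter> {1..c} = {1..c}" if "c \<le> plength (fst l)" for c
      using L that A 2 by (auto simp: Aeq)
    moreover have "card (A \<inter> {n - c<..n}) \<le> c" for c
      using card_mono[of "{n - c<..n}" "A \<inter> {n - c<..n}"] by simp
    ultimately have "1 * real_of_int (bidegree l) \<le> (\<Sum>a\<in>A. real_of_int (highest_weight n l a))"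
      by (intro highest_weight_sum_ge_slope l n A(1)) auto
    then show ?thesis
      using n A(1) d
      by (intro excess_pos_of_slope[where B = "1/2" and \<theta> = 1])
        (use k A 2 in \<open>auto simp: of_nat_diff field_simps\<close>)
  next
    case 3
    obtain \<theta> :: real where \<theta>: "0 \<le> \<theta>" "\<theta> \<le> 1"
      and slope: "\<And>c. c \<le> n div 2 \<Longrightarrow> \<theta> * real c \<le> real (card (A \<inter> {1..c}))"
        "\<And>c. c \<le> n div 2 \<Longrightarrow> real (card (A \<inter> {n - c<..n})) \<le> \<theta> * real c"
      using exists_separating_slope[OF fin(1) few] by metis
    have i: "2 \<le> ?i" "?i \<le> real n - 2"
      using 3 A by linarith+
    \<comment> \<open>Both products are concave in the size of \<open>A\<close>, so they are smallest at the ends of its range.\<close>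
    have "real n - 2 \<le> (?i - 1) * (real n - ?i)"
      using mult_nonneg_nonneg[of "?i - 2" "real n - 1 - ?i"] i by (simp add: algebra_simps)
    moreover have "real n - 2 \<le> ?i * (real n - ?i - 1)"
      using mult_nonneg_nonneg[of "?i - 1" "real n - 2 - ?i"] i by (simp add: algebra_simps)
    ultimately have B: "max ?i (real n - ?i) \<le> ?i * (real n - ?i) - 2 * ?k"
      using k by (simp add: algebra_simps)
    have "\<bar>real n * \<theta> - ?i\<bar> \<le> max ?i (real n - ?i)"
      using mult_left_mono[OF \<theta>(1), of "real n"] mult_left_mono[OF \<theta>(2), of "real n"]
      by (simp add: abs_le_iff max_def)
    moreover have "\<theta> * real_of_int (bidegree l) \<le> (\<Sum>a\<in>A. real_of_int (highest_weight n l a))"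
      using L M by (intro highest_weight_sum_ge_slope l n A(1) slope) auto
    ultimately show ?thesis
      using i B A by (intro excess_pos_of_slope[where B = "max ?i (real n - ?i) / 2" and \<theta> = \<theta>] n d) auto
  qed
qed

section \<open>Failing Weyl group elements\<close>

lemma exists_word_moving:
  assumes "x \<in> {1..n}" "y \<in> {1..n}"
  shows "\<exists>is. set is \<subseteq> {1..<n} \<and> length is = (if x \<le> y then y - x else x - y) \<and> word is x = y"
proof -
  have up: "\<exists>is. set is \<subseteq> {1..<n} \<and> length is = d \<and> word is x = x + d"
    if "1 \<le> x" "x + d \<le> n" for x d
    using that
  proof (induction d)
    case (Suc d)
    then obtain js where "set js \<subseteq> {1..<n}" "length js = d" "word js x = x + d"
      by (metis Suc_leD add_Suc_right)
    then show ?case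
      using Suc.prems by (intro exI[of _ "(x + d) # js"]) (auto simp: simple_reflection_def)
  qed (auto intro: exI[of _ "[]"])
  have down: "\<exists>is. set is \<subseteq> {1..<n} \<and> length is = d \<and> word is (y + d) = y"
    if "1 \<le> y" "y + d \<le> n" for y d
    using that
  proof (induction d arbitrary: y)
    case (Suc d)
    then obtain js where "set js \<subseteq> {1..<n}" "length js = d" "word js (y + 1 + d) = y + 1"
      using Suc.IH[of "y + 1"] by auto
    then show ?case
      using Suc.prems by (intro exI[of _ "y # js"]) (auto simp: simple_reflection_def)
  qed (auto intro: exI[of _ "[]"])
  show ?thesis
    using assms up[of x "y - x"] down[of y "x - y"] by auto
qed

text \<open>The partial sums of the permuted vector agree except for the \<open>j\<close>-th one, in which the entry at \<open>inv \<sigma> j\<close>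
  is replaced by the smaller entry at the later position \<open>inv \<sigma> (Suc j)\<close>.\<close>

lemma nonpos_excess_persists:
  assumes w: "\<And>a b. a \<in> {1..n} \<Longrightarrow> b \<in> {1..n} \<Longrightarrow> a < b \<Longrightarrow> w b < w a"
    and \<sigma>: "\<sigma> permutes {1..n}" and j: "j \<in> {1..<n}" and asc: "inv \<sigma> j < inv \<sigma> (Suc j)"
    and i: "i \<in> {1..<n}" and fail: "excess n w (inv \<sigma> ` {1..i}) \<le> 0"
  shows "excess n w (inv (simple_reflection j \<circ> \<sigma>) ` {1..i}) \<le> 0"
proof -
  let ?s = "simple_reflection j"
  have inj: "inj_on (inv \<sigma>) X" for X
    using permutes_inj[OF permutes_inv[OF \<sigma>]] by (rule inj_on_subset) simp
  have injs: "inj_on ?s X" for X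
    by (rule inj_on_inverseI[of _ ?s]) simp
  have range: "inv \<sigma> j \<in> {1..n}" "inv \<sigma> (Suc j) \<in> {1..n}"
    using permutes_in_image[OF permutes_inv[OF \<sigma>]] j by auto
  have S: "sum w (inv \<sigma> ` X) = (\<Sum>k\<in>X. w (inv \<sigma> k))" for X
    by (simp add: sum.reindex[OF inj])
  have "(\<Sum>k\<in>?s ` {1..i}. w (inv \<sigma> k)) \<le> (\<Sum>k=1..i. w (inv \<sigma> k))"
  proof (cases "i = j")
    case True
    have "?s ` {1..j} = insert (j + 1) {1..<j}"
      using j by (force simp: simple_reflection_def transpose_def image_def)
    moreover have "{1..j} = insert j {1..<j}"
      using j by auto
    ultimately show ?thesis
      using w[OF range asc] True by simp
  next
    case False
    then have "?s k \<in> {1..i}" if "k \<in> {1..i}" for k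
      using that j by (auto simp: simple_reflection_def transpose_def)
    then have "?s ` {1..i} = {1..i}"
      using injs by (intro endo_inj_surj) auto
    then show ?thesis by simp
  qed
  then have "real n * sum w (inv \<sigma> ` ?s ` {1..i}) \<le> real n * sum w (inv \<sigma> ` {1..i})"
    unfolding S by (rule mult_left_mono) simp
  moreover have "inv (?s \<circ> \<sigma>) ` {1..i} = inv \<sigma> ` ?s ` {1..i}"
    by (simp add: inv_simple_reflection_comp[OF \<sigma>] image_comp)
  ultimately show ?thesis
    using fail by (simp add: excess_def card_image[OF inj] card_image[OF injs])
qed

text \<open>The middle position can be moved to either end within \<open>n div 2\<close> steps. A singleton and its complement
  have opposite excess, so one of the two moves produces a failure.\<close>

lemma exists_short_nonpos_excess:
  assumes n: "n \<ge> 2"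
  shows "\<exists>\<sigma>. \<sigma> permutes {1..n} \<and> weyl_length n \<sigma> \<le> n div 2 \<and>
    (\<exists>i\<in>{1..<n}. excess n w (inv \<sigma> ` {1..i}) \<le> 0)"
proof -
  define k where "k = n div 2 + 1"
  have k: "k \<in> {1..n}"
    using n by (auto simp: k_def)
  have inv_eq: "inv (word is) y = k" if "set is \<subseteq> {1..<n}" "word is k = y" for "is" y
    using permutes_inverses(2)[OF word_permutes[OF that(1)], of k] that(2) by simp
  show ?thesis
  proof (cases "excess n w {k} \<le> 0")
    case True
    obtain "is" where ws: "set is \<subseteq> {1..<n}" "length is = k - 1" "word is k = 1"
      using exists_word_moving[of k n 1] k n by (auto split: if_splits)
    have "inv (word is) ` {1..1} = {k}"
      using inv_eq[OF ws(1,3)] by simp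
    moreover have "weyl_length n (word is) \<le> n div 2"
      using weyl_length_le_word[OF ws(1)] ws(2) by (simp add: k_def)
    ultimately show ?thesis
      using True n word_permutes[OF ws(1)] by (intro exI[of _ "word is"] conjI bexI[of _ 1]) auto
  next
    case False
    obtain "is" where ws: "set is \<subseteq> {1..<n}" "length is = n - k" "word is k = n"
      using exists_word_moving[of k n n] k n by auto
    have p: "word is permutes {1..n}"
      using ws(1) by (rule word_permutes)
    have "{1..n-1} = {1..n} - {n}"
      using n by auto
    then have "inv (word is) ` {1..n-1} = {1..n} - {k}"
      using image_set_diff[OF permutes_inj[OF permutes_inv[OF p]]]
        permutes_image[OF permutes_inv[OF p]] inv_eq[OF ws(1,3)] by simp
    then have "excess n w (inv (word is) ` {1..n-1}) \<le> 0"
      using False excess_complement[of "{k}" n w] k by simp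
    moreover have "n - 1 \<in> {1..<n}"
      using n by auto
    moreover have "weyl_length n (word is) \<le> n div 2"
      using weyl_length_le_word[OF ws(1)] ws(2) by (simp add: k_def)
    ultimately show ?thesis
      using p by blast
  qed
qed

lemma exists_nonpos_excess_of_length:
  assumes w: "\<And>a b. a \<in> {1..n} \<Longrightarrow> b \<in> {1..n} \<Longrightarrow> a < b \<Longrightarrow> w b < w a"
    and n: "n \<ge> 2" and q: "n div 2 \<le> q" "q \<le> weyl_length n \<tau>" and \<tau>: "\<tau> permutes {1..n}"
  shows "\<exists>\<sigma>. \<sigma> permutes {1..n} \<and> weyl_length n \<sigma> = q \<and>
    (\<exists>i\<in>{1..<n}. excess n w (inv \<sigma> ` {1..i}) \<le> 0)"
proof -
  obtain \<sigma>0 where \<sigma>0: "\<sigma>0 permutes {1..n}" "weyl_length n \<sigma>0 \<le> n div 2"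
      "\<exists>i\<in>{1..<n}. excess n w (inv \<sigma>0 ` {1..i}) \<le> 0"
    using exists_short_nonpos_excess[OF n] by blast
  have "weyl_length n \<sigma>0 \<le> q"
    using \<sigma>0(2) q(1) by simp
  then show ?thesis
    using q(2)
  proof (induction q rule: dec_induct)
    case base
    then show ?case
      using \<sigma>0 by blast
  next
    case (step r)
    then obtain \<sigma> i where \<sigma>: "\<sigma> permutes {1..n}" "weyl_length n \<sigma> = r"
        "i \<in> {1..<n}" "excess n w (inv \<sigma> ` {1..i}) \<le> 0"
      by auto
    then obtain j where j: "j \<in> {1..<n}" "inv \<sigma> j < inv \<sigma> (Suc j)"
      using exists_ascent_below_longest[OF \<sigma>(1) _ \<tau>] step.prems by auto
    have p: "simple_reflection j \<circ> \<sigma> permutes {1..n}"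
      using \<sigma>(1) simple_reflection_permutes[OF j(1)] by (rule permutes_compose)
    moreover have "weyl_length n (simple_reflection j \<circ> \<sigma>) = Suc r"
      using card_inversions_ascent[OF \<sigma>(1) j] \<sigma>(1,2) p
      by (simp add: weyl_length_eq_card_inversions)
    ultimately show ?case
      using nonpos_excess_persists[OF w \<sigma>(1) j \<sigma>(3,4)] \<sigma>(3) by blast
  qed
qed

section \<open>The bound on \<open>C'\<close>\<close>

text \<open>A permutation that moves \<open>n\<close> to the first place has \<open>{n}\<close> as preimage of \<open>{1}\<close>, so
  its length is at least \<open>n - 1\<close>. Hence \<open>n div 2 - 1\<close> is in the range over which the maximum is taken.\<close>

lemma weyl_length_longest_ge:
  assumes "n \<ge> 1"
  shows "n - 1 \<le> weyl_length n (longest_element n)"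
proof -
  have p: "transpose 1 n permutes {1..n}"
    using assms by (intro permutes_swap_id) auto
  have "\<Sum>(inv (transpose 1 n) ` {1..1}) \<le> \<Sum>{1..1} + weyl_length n (transpose 1 n)"
    by (rule sum_inv_image_le[OF p])
  then have "n - 1 \<le> weyl_length n (transpose 1 n)"
    by simp
  also have "\<dots> \<le> weyl_length n (longest_element n)"
    by (rule weyl_length_le_longest[OF p])
  finally show ?thesis .
qed

theorem theorem3p2:
  fixes n :: nat and l :: bipart
  assumes "n \<ge> 2"
    and "bipartition l"
    and "n \<ge> bilength l"
  shows "int (C' n l) \<le> \<lfloor>real n / 2\<rfloor> - 1 \<and>
         (int n \<ge> n_B l \<longrightarrow> int (C' n l) = \<lfloor>real n / 2\<rfloor> - 1)"
proof -
  let ?w = "shifted_weight n l" and ?N = "weyl_length n (longest_element n)"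
  define Q where "Q = {q \<in> {0..?N}.
    \<forall>\<sigma> \<in> weyl_of_length n q. positive_weight n (weyl_act \<sigma> (rho_plus_mu n l))}"
  have C: "C' n l = Max Q"
    by (simp add: C'_def Q_def)
  have dec: "?w b < ?w a" if "a \<in> {1..n}" "b \<in> {1..n}" "a < b" for a b
    using shifted_weight_strict_antimono[OF assms(2,3) that] .
  have Q: "q \<in> Q \<longleftrightarrow> q \<le> ?N \<and> (\<forall>\<sigma>. \<sigma> permutes {1..n} \<and> weyl_length n \<sigma> = q \<longrightarrow>
      (\<forall>i\<in>{1..<n}. 0 < excess n ?w (inv \<sigma> ` {1..i})))" for q
    using positive_weyl_act_iff_excess[of n _ "rho_plus_mu n l" ?w] rho_plus_mu_eq[of _ n l] assms(1)
    by (auto simp: Q_def weyl_of_length_def weyl_group_def)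
  have "0 \<in> Q"
  proof -
    have "inv \<sigma> = id" if "\<sigma> permutes {1..n}" "weyl_length n \<sigma> = 0" for \<sigma>
      using obtain_reduced_word[OF that(1)] that(2) by (metis inv_id length_0_conv word.simps(1))
    then show ?thesis
      using excess_initial_pos[of n ?w, OF dec] by (simp add: Q)
  qed
  have fin: "finite Q"
    by (simp add: Q_def)
  have upper: "q < n div 2" if "q \<in> Q" for q
  proof (rule ccontr)
    assume "\<not> q < n div 2"
    then have "n div 2 \<le> q" "q \<le> ?N"
      using that by (simp_all add: Q)
    then obtain \<sigma> i where "\<sigma> permutes {1..n}" "weyl_length n \<sigma> = q" "i \<in> {1..<n}"
        "excess n ?w (inv \<sigma> ` {1..i}) \<le> 0"
      using exists_nonpos_excess_of_length[where w = ?w and n = n,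
          OF dec assms(1) _ _ longest_element_permutes]
      by blast
    then show False
      using that unfolding Q by force
  qed
  have floor: "\<lfloor>real n / 2\<rfloor> = int (n div 2)"
    using floor_divide_of_nat_eq[of n 2] by simp
  have "Max Q < n div 2"
    using upper Max_in[OF fin] \<open>0 \<in> Q\<close> by blast
  moreover have "n div 2 - 1 \<le> Max Q" if nB: "int n \<ge> n_B l"
  proof (rule Max_ge[OF fin])
    have "0 < excess n ?w (inv \<sigma> ` {1..i})"
      if \<sigma>: "\<sigma> permutes {1..n}" "weyl_length n \<sigma> = n div 2 - 1" and i: "i \<in> {1..<n}" for \<sigma> i
    proof -
      let ?A = "inv \<sigma> ` {1..i}"
      have A: "?A \<subseteq> {1..n}"
        using permutes_image[OF permutes_inv[OF \<sigma>(1)]] i by fastforce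
      have card: "card ?A = i"
        using permutes_inj[OF permutes_inv[OF \<sigma>(1)]] by (simp add: card_image inj_on_subset)
      have "2 * \<Sum>{1..i} = i * (i + 1)"
        by (induction i) auto
      moreover have "\<Sum>?A \<le> \<Sum>{1..i} + weyl_length n \<sigma>"
        by (rule sum_inv_image_le[OF \<sigma>(1)])
      moreover have "i * (i + 1) + 2 * card (crossings ?A) = 2 * \<Sum>?A"
        using crossings_sum[of ?A] contra_subsetD[OF A, of 0] unfolding card by simp
      ultimately have "card (crossings ?A) \<le> weyl_length n \<sigma>"
        by linarith
      then have "card (crossings ?A) < n div 2"
        using \<sigma>(2) assms(1) by linarith
      then show ?thesis
        using excess_pos_of_few_crossings[OF assms(2,3) nB A] i card by auto
    qed
    moreover have "n div 2 - 1 \<le> ?N"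
      using weyl_length_longest_ge[of n] assms(1) by linarith
    ultimately show "n div 2 - 1 \<in> Q"
      by (auto simp: Q)
  qed
  ultimately show ?thesis
    unfolding C floor using assms(1) by auto
qed

end
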